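(* Let $b \ge 2$ be an integer, $A = \{0,1,\ldots,b-1\}$ and $\widehat{A} = \{0,1,\ldots,b\}$. Let $v \in A^{\omega}$ be a normal word (to the alphabet $A$). Then there exists a word $\widehat{v} \in \widehat{A}^{\omega}$, normal (to the alphabet $\widehat{A}$), such that $r(\widehat{v}) = v$, where $r$ is the operator that removes all occurrences of the symbol $b$.
   Context: An alphabet is a finite set of symbols. For an alphabet $C$, $C^{k}$ is the set of words of length $k$, $C^*$ the set of finite words and $C^{\omega}$ the set of infinite words (sequences indexed by $1,2,3,\ldots$) over $C$. Positions are numbered from $1$; $u[i,j]$ is the substring of $u$ from position $i$ to position $j$; $|u|$ is the length of a finite word $u$. Aligned occurrences: for finite words $u,v \in C^*$ with $v$ nonempty, $$\|u\|_v = |\{\, i : 1 \le i \leq |u|-|v|+1,\ u[i,i+|v|-1] = v \text{ and } i \equiv 1 \bmod |v| \,\}|.$$ Normality: a word $u \in C^{\omega}$ is simply normal to length $\ell$ (with respect to the alphabet $C$) if for every $v \in C^{\ell}$, $$\lim_{n\to\infty} \frac{\|u[1,\ell n]\|_v}{n} = \frac{1}{|C|^{\ell}}.$$ It is normal (to the alphabet $C$) if it is simply normal to every length $\ell \in \mathbb{N}=\{1,2,\ldots\}$. Reduction operator: for a finite or infinite word $x$ over $\widehat{A}$, $r(x)$ is the word over $A$ obtained from $x$ by deleting all occurrences of the symbol $b$ and keeping the remaining symbols in their order. *)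

theory Defs
  imports Complex_Main "HOL-Library.Omega_Words_Fun" "HOL-Number_Theory.Cong"
begin

text \<open>
  Infinite words are functions on \<^typ>\<open>nat\<close> and finite words are lists, both indexed from 0;
  position \<open>i\<close> in the numbering from 1 is index \<open>i - 1\<close>, so \<open>u[1,k]\<close> is \<open>prefix k u\<close>.
\<close>

definition finite_words_of_length :: "'a set \<Rightarrow> nat \<Rightarrow> 'a list set" where
  "finite_words_of_length C k = {w. set w \<subseteq> C \<and> length w = k}"

definition infinite_words :: "'a set \<Rightarrow> 'a word set" where
  "infinite_words C = {u. range u \<subseteq> C}"

text \<open>
  The bound \<open>i \<le> |u| - |v| + 1\<close> is written additively, since subtraction on \<^typ>\<open>nat\<close> truncates.
  Only nonempty \<open>v\<close> are meant.
\<close>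

definition aligned_occurrences :: "'a list \<Rightarrow> 'a list \<Rightarrow> nat" where
  "aligned_occurrences u v =
     card {i. 1 \<le> i \<and> i + length v \<le> length u + 1 \<and>
              take (length v) (drop (i - 1) u) = v \<and> [i = 1] (mod length v)}"

definition simply_normal_to_length :: "'a set \<Rightarrow> nat \<Rightarrow> 'a word \<Rightarrow> bool" where
  "simply_normal_to_length C l u \<longleftrightarrow>
     (\<forall>v \<in> finite_words_of_length C l.
        (\<lambda>n. real (aligned_occurrences (prefix (l * n) u) v) / real n)
          \<longlonglongrightarrow> 1 / real (card C) ^ l)"

definition normal_word :: "'a set \<Rightarrow> 'a word \<Rightarrow> bool" where
  "normal_word C u \<longleftrightarrow> (\<forall>l\<ge>1. simply_normal_to_length C l u)"

datatype 'a finite_or_infinite_word = FinWord "'a list" | InfWord "'a word"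

text \<open>
  Deleting a symbol from an infinite word leaves an infinite word exactly when infinitely many
  positions survive; its letters are then those at the surviving positions in increasing order.
\<close>

fun delete_symbol :: "'a \<Rightarrow> 'a finite_or_infinite_word \<Rightarrow> 'a finite_or_infinite_word" where
  "delete_symbol b (FinWord w) = FinWord (filter (\<lambda>c. c \<noteq> b) w)"
| "delete_symbol b (InfWord x) =
     (if finite {i. x i \<noteq> b}
      then FinWord (map x (sorted_list_of_set {i. x i \<noteq> b}))
      else InfWord (\<lambda>n. x (enumerate {i. x i \<noteq> b} n)))"

end

theory Submission
  imports Defs "HOL-Real_Asymp.Real_Asymp"
begin

text \<open>
  Let \<open>k\<close> be the number of letters of \<open>A\<close>. A uniformly random word over the extended alphabet of
  length \<open>(k + 1) q\<close> contains about \<open>q\<close> copies of the new symbol \<open>b\<close>. Force this number to be exactly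
  \<open>q\<close>: then every block of \<open>k q\<close> letters of \<open>v\<close> is expanded to a block of \<open>(k + 1) q\<close> symbols, and
  there are equally many expansions, namely \<open>(k + 1) q\<close> choose \<open>q\<close>, of every block of \<open>v\<close>. For each
  block content run cyclically through its expansions at its successive occurrences
  (\<open>round_robin\<close>). Since the blocks of \<open>v\<close> are equidistributed, the expanded blocks are
  equidistributed among all words of length \<open>(k + 1) q\<close> with exactly \<open>q\<close> symbols \<open>b\<close>.

  In the resulting word \<open>X\<^sub>q\<close> the frequency of a short word \<open>z\<close> can be computed exactly
  (\<open>balanced_insertion\<close>): fixing \<open>z\<close> as a window of such a block leaves a word of length
  \<open>(k + 1) q - |z|\<close> with \<open>q - |z|\<^sub>b\<close> symbols \<open>b\<close>, at whatever position the window lies. The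
  frequency is therefore a quotient of two numbers of the form \<open>(n choose m) * k ^ (n - m)\<close>, and
  it tends to \<open>1 / (k + 1) ^ |z|\<close> as \<open>q\<close> grows (\<open>window_ratio_tendsto\<close>).

  No single \<open>X\<^sub>q\<close> is normal, because each of its blocks has exactly \<open>q\<close> symbols \<open>b\<close>. The final word
  follows \<open>X\<^sub>q\<close> for \<open>q = 0!, 1!, 2!, \<dots>\<close> in turn. It moves on to the next of these words only at
  a position by which the frequencies of that word have settled near their limit, and each stage
  is long enough to outweigh everything before it (\<open>splice_discrepancy\<close>).
  All these words expand the same stretch of \<open>v\<close> between two common block boundaries, so switching
  there leaves the reduced word unchanged.
\<close>

section \<open>Counting aligned blocks\<close>

definition hits :: "(nat \<Rightarrow> 'a) \<Rightarrow> 'a \<Rightarrow> nat \<Rightarrow> nat" where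
  "hits f a n = card {t. t < n \<and> f t = a}"

definition block :: "nat \<Rightarrow> 'a word \<Rightarrow> nat \<Rightarrow> 'a list" where
  "block l x j = map x [j * l..<j * l + l]"

lemma length_block [simp]: "length (block l x j) = l"
  by (simp add: block_def)

lemma hits_0 [simp]: "hits f a 0 = 0"
  by (simp add: hits_def)

lemma hits_Suc: "hits f a (Suc n) = hits f a n + (if f n = a then 1 else 0)"
proof -
  have "{t. t < Suc n \<and> f t = a} = {t. t < n \<and> f t = a} \<union> (if f n = a then {n} else {})"
    by (auto simp: less_Suc_eq)
  then show ?thesis by (simp add: hits_def card_insert_if)
qed

lemma hits_add: "hits f a (m + n) = hits f a m + hits (\<lambda>e. f (m + e)) a n"
  by (induction n) (simp_all add: hits_Suc)

lemma hits_le: "hits f a n \<le> n"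
  by (induction n) (simp_all add: hits_Suc)

lemma hits_cong: "(\<And>t. t < n \<Longrightarrow> f t = g t) \<Longrightarrow> hits f a n = hits g a n"
  unfolding hits_def by (rule arg_cong[of _ _ card]) auto

text \<open>Grouping a sum along a sequence by the values that occur turns it into a combination of
  counts, which is how frequencies of long blocks determine frequencies of shorter ones.\<close>
lemma sum_by_value:
  fixes g :: "'a \<Rightarrow> nat"
  assumes "finite \<Omega>" and "\<And>t. f t \<in> \<Omega>"
  shows "(\<Sum>t<T. g (f t)) = (\<Sum>w\<in>\<Omega>. hits f w T * g w)"
proof (induction T)
  case (Suc T)
  have "(\<Sum>w\<in>\<Omega>. hits f w (Suc T) * g w)
      = (\<Sum>w\<in>\<Omega>. hits f w T * g w) + (\<Sum>w\<in>\<Omega>. if f T = w then g w else 0)"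
    by (simp add: hits_Suc sum.distrib[symmetric]) (rule sum.cong, auto)
  then show ?case using Suc assms by (simp add: sum.delta')
qed simp

text \<open>The admissible positions are exactly the \<open>j * l + 1\<close> with \<open>j < n\<close>, so aligned occurrences are
  visits of the sequence of consecutive blocks to \<open>z\<close>.\<close>
lemma aligned_occurrences_eq_hits:
  assumes "length z = l" "l \<ge> 1"
  shows "aligned_occurrences (prefix (l * n) u) z = hits (block l u) z n"
proof -
  have *: "take l (drop (j * l) (prefix (l * n) u)) = block l u j" if "j < n" for j
  proof -
    have "j * l + l \<le> l * n"
      using that mult_le_mono1[of "Suc j" n l] by (simp add: mult.commute)
    then show ?thesis by (simp add: block_def subsequence_def drop_map take_map)
  qed
  have "{i. 1 \<le> i \<and> i + length z \<le> length (prefix (l * n) u) + 1 \<and>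
          take (length z) (drop (i - 1) (prefix (l * n) u)) = z \<and> [i = 1] (mod length z)}
      = (\<lambda>j. j * l + 1) ` {j. j < n \<and> block l u j = z}" (is "?L = ?R")
  proof (intro equalityI subsetI)
    fix i assume i: "i \<in> ?L"
    then have "[i = 1] (mod l)" "1 \<le> i" using assms by auto
    then have "l dvd i - 1" using cong_altdef_nat[of 1 i l] by simp
    then obtain j where j: "i - 1 = j * l" by (auto simp: dvd_def mult.commute)
    have i1: "i = j * l + 1" using j i by auto
    have "j * l + l \<le> l * n" using i assms i1 by simp
    then have "Suc j * l \<le> n * l" by (simp add: mult.commute)
    moreover have "0 < l" using assms(2) by simp
    ultimately have "j < n" by (simp only: mult_le_cancel2 Suc_le_eq)
    then show "i \<in> ?R" using i i1 *[of j] assms by auto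
  next
    fix i assume "i \<in> ?R"
    then obtain j where j: "i = j * l + 1" "j < n" "block l u j = z" by auto
    have "Suc j * l \<le> n * l" using j(2) by (intro mult_le_mono1) simp
    moreover have "[i = 1] (mod l)" using j(1) by (simp add: cong_altdef_nat)
    ultimately show "i \<in> ?L" using j *[of j] assms by (simp add: mult.commute)
  qed
  moreover have "inj_on (\<lambda>j. j * l + 1) {j. j < n \<and> block l u j = z}"
    using assms by (auto simp: inj_on_def)
  ultimately show ?thesis by (simp add: aligned_occurrences_def hits_def card_image)
qed

lemma simply_normal_iff_hits:
  assumes "l \<ge> 1"
  shows "simply_normal_to_length C l u \<longleftrightarrow>
    (\<forall>z. set z \<subseteq> C \<longrightarrow> length z = l \<longrightarrow>
      (\<lambda>n. real (hits (block l u) z n) / real n) \<longlonglongrightarrow> 1 / real (card C) ^ l)"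
  using assms
  by (auto simp: simply_normal_to_length_def finite_words_of_length_def aligned_occurrences_eq_hits)

section \<open>Distributing choices evenly\<close>

lemma hits_mod:
  assumes "r < M"
  shows "hits (\<lambda>k. k mod M) r N = (N + (M - 1 - r)) div M"
proof (induction N)
  case 0
  then show ?case using assms by simp
next
  case (Suc N)
  have "(N mod M = r) = (Suc (N + (M - 1 - r)) mod M = 0)"
  proof -
    define x where "x = N mod M"
    have x: "x < M" using assms by (simp add: x_def)
    have "Suc (N + (M - 1 - r)) = N + (M - r)" using assms by simp
    then have "Suc (N + (M - 1 - r)) mod M = (N + (M - r)) mod M" by presburger
    also have "\<dots> = (x + (M - r)) mod M" by (simp add: x_def mod_simps)
    also have "\<dots> = (if x < r then x + (M - r) else x - r)"
    proof (cases "x < r")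
      case False
      then have "x + (M - r) = x - r + M" using assms by simp
      then have "(x + (M - r)) mod M = (x - r) mod M" by (metis mod_add_self2)
      then show ?thesis using False x by simp
    qed (use assms in simp)
    finally show ?thesis using assms by (auto simp: x_def)
  qed
  then show ?case using Suc by (simp add: hits_Suc div_Suc)
qed

text \<open>
  A deterministic substitute for independent uniform choices: the \<open>n\<close>-th occurrence of a value \<open>a\<close>
  receives the element of \<open>R a\<close> with number \<open>n\<close> modulo the size of \<open>R a\<close>. Each element of \<open>R a\<close> is
  then chosen equally often up to an error of one, however irregularly \<open>a\<close> occurs.
\<close>
lemma round_robin:
  fixes u :: "nat \<Rightarrow> 'a" and R :: "'a \<Rightarrow> 'c set"
  assumes u: "\<And>t. u t \<in> D"
    and fin: "\<And>a. a \<in> D \<Longrightarrow> finite (R a)" and ne: "\<And>a. a \<in> D \<Longrightarrow> R a \<noteq> {}"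
  shows "\<exists>w. (\<forall>t. w t \<in> R (u t)) \<and>
    (\<forall>a\<in>D. \<forall>c\<in>R a. \<forall>T.
      \<bar>real (hits (\<lambda>t. (u t, w t)) (a, c) T) - real (hits u a T) / real (card (R a))\<bar> \<le> 1)"
proof -
  have "\<exists>e. bij_betw e {0..<card (R a)} (R a)" if "a \<in> D" for a
    using ex_bij_betw_nat_finite[of "R a"] fin that by auto
  then obtain e where e: "bij_betw (e a) {0..<card (R a)} (R a)" if "a \<in> D" for a
    by metis
  have pos: "card (R a) > 0" if "a \<in> D" for a
    using that fin ne by (auto simp: card_gt_0_iff)
  define w where "w t = e (u t) (hits u (u t) t mod card (R (u t)))" for t
  have "w t \<in> R (u t)" for t
    unfolding w_def using bij_betwE[OF e[OF u]] pos[OF u] by simp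
  moreover have "\<bar>real (hits (\<lambda>t. (u t, w t)) (a, c) T) - real (hits u a T) / real (card (R a))\<bar> \<le> 1"
    if a: "a \<in> D" and c: "c \<in> R a" for a c T
  proof -
    let ?M = "card (R a)"
    obtain r where r: "r < ?M" "e a r = c"
      using e[OF a] c unfolding bij_betw_def by (metis imageE atLeastLessThan_iff)
    have inj: "e a k = c \<longleftrightarrow> k = r" if "k < ?M" for k
      using e[OF a] r that by (auto simp: bij_betw_def inj_on_def)
    have "hits (\<lambda>t. (u t, w t)) (a, c) T = hits (\<lambda>k. k mod ?M) r (hits u a T)"
    proof (induction T)
      case (Suc T)
      show ?case
      proof (cases "u T = a")
        case True
        then have "(w T = c) = (hits u a T mod ?M = r)"
          using inj[of "hits u a T mod ?M"] pos[OF a] by (simp add: w_def)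
        then show ?thesis using Suc True by (simp add: hits_Suc)
      qed (use Suc in \<open>simp add: hits_Suc\<close>)
    qed simp
    also have "\<dots> = (hits u a T + (?M - 1 - r)) div ?M"
      using hits_mod[OF r(1)] .
    finally have eq: "hits (\<lambda>t. (u t, w t)) (a, c) T = (hits u a T + (?M - 1 - r)) div ?M" .
    define N h where "N = hits u a T" and "h = (N + (?M - 1 - r)) div ?M"
    have "h * ?M \<le> N + (?M - 1 - r)" "N + (?M - 1 - r) < Suc h * ?M"
      unfolding h_def using pos[OF a] by (auto simp: dividend_less_div_times)
    then have "h * ?M \<le> N + ?M" "N \<le> h * ?M + ?M" using r(1) by auto
    then have "real h * real ?M \<le> real N + real ?M" "real N \<le> real h * real ?M + real ?M"
      by (metis of_nat_le_iff of_nat_add of_nat_mult)+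
    then have "\<bar>real h - real N / real ?M\<bar> \<le> 1"
      using pos[OF a] by (simp add: abs_le_iff field_simps)
    then show ?thesis by (simp add: eq h_def N_def)
  qed
  ultimately show ?thesis by blast
qed

section \<open>Words with a prescribed number of insertions\<close>

definition insertions :: "'a \<Rightarrow> nat \<Rightarrow> 'a list \<Rightarrow> 'a list set" where
  "insertions b N u = {w. length w = N \<and> filter (\<lambda>c. c \<noteq> b) w = u}"

definition words_with_count :: "'a set \<Rightarrow> 'a \<Rightarrow> nat \<Rightarrow> nat \<Rightarrow> 'a list set" where
  "words_with_count A b N q = {w. set w \<subseteq> insert b A \<and> length w = N \<and> count_list w b = q}"

text \<open>The number of ways to insert \<open>b\<close> depends only on the length of \<open>u\<close>: a word is determined by
  \<open>u\<close> and the set of positions of its letters other than \<open>b\<close>. This is why equidistributed \<open>u\<close>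
  lead to equidistributed expansions. The recursion on the first symbol is Pascal's rule.\<close>
lemma card_insertions:
  assumes "b \<notin> set u"
  shows "finite (insertions b N u) \<and> card (insertions b N u) = N choose length u"
  using assms
proof (induction N arbitrary: u)
  case 0
  have "insertions b 0 u = (if u = [] then {[]} else {})"
    by (auto simp: insertions_def)
  then show ?case by (cases u) auto
next
  case (Suc N)
  show ?case
  proof (cases u)
    case Nil
    have "insertions b (Suc N) u = (#) b ` insertions b N u"
      by (auto simp: insertions_def length_Suc_conv Nil image_iff split: if_splits)
    then show ?thesis using Suc.IH[of u] Suc.prems Nil by (simp add: card_image)
  next
    case (Cons a u')
    have split: "insertions b (Suc N) u = (#) b ` insertions b N u \<union> (#) a ` insertions b N u'"
      using Suc.prems
      by (auto simp: insertions_def length_Suc_conv Cons image_iff split: if_splits)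
    have "(#) b ` insertions b N u \<inter> (#) a ` insertions b N u' = {}"
      using Suc.prems Cons by auto
    then show ?thesis using Suc.IH[of u] Suc.IH[of u'] Suc.prems Cons
      by (simp add: split[unfolded Cons] card_Un_disjoint card_image)
  qed
qed

lemma length_filter_neq: "length (filter (\<lambda>c. c \<noteq> b) w) + count_list w b = length w"
  by (induction w) auto

lemma card_words_with_count:
  assumes "finite A" "b \<notin> A" "q \<le> N"
  shows "card (words_with_count A b N q) = (N choose q) * card A ^ (N - q)"
proof -
  let ?U = "{u. set u \<subseteq> A \<and> length u = N - q}"
  have "words_with_count A b N q = (\<Union>u\<in>?U. insertions b N u)"
  proof (intro equalityI subsetI)
    fix w assume w: "w \<in> words_with_count A b N q"
    then show "w \<in> (\<Union>u\<in>?U. insertions b N u)"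
      using length_filter_neq[of b w] by (auto simp: words_with_count_def insertions_def)
  next
    fix w assume w: "w \<in> (\<Union>u\<in>?U. insertions b N u)"
    then have "set (filter (\<lambda>c. c \<noteq> b) w) \<subseteq> A" "length w = N"
        "length (filter (\<lambda>c. c \<noteq> b) w) = N - q"
      by (auto simp: insertions_def)
    then show "w \<in> words_with_count A b N q"
      using length_filter_neq[of b w] assms(3) by (auto simp: words_with_count_def)
  qed
  moreover have "card (\<Union>u\<in>?U. insertions b N u) = (\<Sum>u\<in>?U. card (insertions b N u))"
  proof (rule card_UN_disjoint)
    show "finite ?U" using assms finite_lists_length_eq by blast
    show "\<forall>u\<in>?U. finite (insertions b N u)" using assms card_insertions by fastforce
    show "\<forall>u\<in>?U. \<forall>u'\<in>?U. u \<noteq> u' \<longrightarrow> insertions b N u \<inter> insertions b N u' = {}"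
      by (auto simp: insertions_def)
  qed
  moreover have "(\<Sum>u\<in>?U. card (insertions b N u)) = (\<Sum>u\<in>?U. N choose q)"
  proof (rule sum.cong)
    fix u assume "u \<in> ?U"
    then have "b \<notin> set u" "length u = N - q" using assms by auto
    then show "card (insertions b N u) = N choose q"
      using card_insertions[of b u N] assms binomial_symmetric[of q N] by simp
  qed simp
  ultimately show ?thesis using assms by (simp add: card_lists_length_eq mult.commute)
qed

lemma finite_words_with_count: "finite A \<Longrightarrow> finite (words_with_count A b N q)"
  by (rule finite_subset[OF _ finite_lists_length_eq[of "insert b A" N]])
    (auto simp: words_with_count_def)

text \<open>Cutting out the window \<open>z\<close> and joining the two remaining pieces is a bijection, so the number
  of words showing \<open>z\<close> at position \<open>s\<close> is the same for all \<open>s\<close>.\<close>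
lemma card_words_with_count_window:
  assumes "set z \<subseteq> insert b A" "s + length z \<le> N" "count_list z b \<le> q"
  shows "card {w \<in> words_with_count A b N q. take (length z) (drop s w) = z}
       = card (words_with_count A b (N - length z) (q - count_list z b))"
proof (rule bij_betw_same_card[of "\<lambda>w. take s w @ drop (s + length z) w"],
    rule bij_betw_byWitness[where f' = "\<lambda>y. take s y @ z @ drop s y"])
  let ?S = "{w \<in> words_with_count A b N q. take (length z) (drop s w) = z}"
  let ?Y = "words_with_count A b (N - length z) (q - count_list z b)"
  have dec: "w = take s w @ z @ drop (s + length z) w" if "w \<in> ?S" for w
  proof -
    have "w = take s w @ take (length z) (drop s w) @ drop (length z) (drop s w)"
      by (metis append_take_drop_id)
    then show ?thesis using that by (simp add: add.commute)
  qed
  show "\<forall>w\<in>?S. take s (take s w @ drop (s + length z) w) @ z @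
      drop s (take s w @ drop (s + length z) w) = w"
  proof
    fix w assume w: "w \<in> ?S"
    then have "length (take s w) = s" using assms by (auto simp: words_with_count_def)
    then show "take s (take s w @ drop (s + length z) w) @ z @
      drop s (take s w @ drop (s + length z) w) = w" using dec[OF w] by simp
  qed
  show "\<forall>y\<in>?Y. take s (take s y @ z @ drop s y) @
      drop (s + length z) (take s y @ z @ drop s y) = y"
    using assms by (auto simp: words_with_count_def)
  show "(\<lambda>w. take s w @ drop (s + length z) w) ` ?S \<subseteq> ?Y"
  proof safe
    fix w assume w: "w \<in> words_with_count A b N q" "take (length z) (drop s w) = z"
    then have w': "w = take s w @ z @ drop (s + length z) w" using dec by simp
    have "count_list w b = count_list (take s w) b + count_list z b
        + count_list (drop (s + length z) w) b"
      by (subst w') simp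
    then show "take s w @ drop (s + length z) w \<in> ?Y"
      using w(1) assms(2) by (auto simp: words_with_count_def dest!: in_set_takeD in_set_dropD)
  qed
  show "(\<lambda>y. take s y @ z @ drop s y) ` ?Y \<subseteq> ?S"
  proof safe
    fix y assume y: "y \<in> ?Y"
    have "count_list (take s y @ drop s y) b = q - count_list z b"
      using y by (simp add: words_with_count_def)
    then have "count_list (take s y) b + count_list (drop s y) b = q - count_list z b"
      by (simp del: append_take_drop_id)
    then show "take s y @ z @ drop s y \<in> words_with_count A b N q"
      using y assms by (auto simp: words_with_count_def dest!: in_set_takeD in_set_dropD)
    show "take (length z) (drop s (take s y @ z @ drop s y)) = z"
      using y assms by (auto simp: words_with_count_def)
  qed
qed

text \<open>The next two identities give the factor by which the count changes when a window is
  extended by one symbol, which is either \<open>b\<close> or a letter of \<open>A\<close>.\<close>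
lemma card_words_with_count_drop_symbol:
  assumes "finite A" "b \<notin> A" "p \<le> N"
  shows "card (words_with_count A b N p) * Suc N = card (words_with_count A b (Suc N) (Suc p)) * Suc p"
  using assms Suc_times_binomial[of p N]
  by (simp add: card_words_with_count del: binomial_Suc_Suc mult_Suc mult_Suc_right)
    (metis mult.assoc mult.commute)

lemma card_words_with_count_drop_letter:
  assumes "finite A" "b \<notin> A" "q \<le> N"
  shows "card (words_with_count A b N q) * (Suc N * card A)
       = card (words_with_count A b (Suc N) q) * (Suc N - q)"
proof -
  have "(Suc N - q) * (Suc N choose q) = Suc N * (N choose q)"
    using binomial_absorb_comp[of "Suc N" q] by simp
  moreover have "card A ^ (Suc N - q) = card A * card A ^ (N - q)"
    using assms by (simp add: Suc_diff_le)
  ultimately show ?thesis using assms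
    by (simp add: card_words_with_count del: mult_Suc mult_Suc_right) (metis mult.assoc mult.commute)
qed

text \<open>
  The ratio is the probability that a uniformly random word with \<open>q\<close> symbols \<open>b\<close> among
  \<open>(k + 1) q\<close> starts with \<open>z\<close>. Sampling without replacement approaches independent
  sampling: each symbol of \<open>z\<close> contributes a factor, \<open>f q\<close> below, that tends to \<open>1 / (k + 1)\<close>.
\<close>
lemma window_ratio_tendsto:
  assumes "finite A" "b \<notin> A" "A \<noteq> {}" "set z \<subseteq> insert b A"
  defines "k \<equiv> card A"
  shows "(\<lambda>q. real (card (words_with_count A b ((k + 1) * q - length z) (q - count_list z b)))
            / real (card (words_with_count A b ((k + 1) * q) q))) \<longlonglongrightarrow> 1 / real (k + 1) ^ length z"
  using assms(4)
proof (induction z)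
  case Nil
  have "card (words_with_count A b ((k + 1) * q) q) > 0" for q
    using assms by (simp add: card_words_with_count card_gt_0_iff)
  then have "(\<lambda>q. real (card (words_with_count A b ((k + 1) * q) q))
            / real (card (words_with_count A b ((k + 1) * q) q))) = (\<lambda>_. 1)"
    by (metis divide_self_if less_numeral_extra(3) of_nat_eq_0_iff)
  then show ?case by simp
next
  case (Cons c z)
  have k: "k > 0" using assms by (simp add: card_gt_0_iff)
  let ?h = "\<lambda>z q. real (card (words_with_count A b ((k + 1) * q - length z) (q - count_list z b)))"
  define l j where "l = length z" and "j = count_list z b"
  have jl: "j \<le> l" unfolding l_def j_def using length_filter_neq[of b z] by simp
  define f where "f q = (if c = b then real (q - j) / real ((k + 1) * q - l)
     else real ((k + 1) * q - l - (q - j)) / (real k * real ((k + 1) * q - l)))" for q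
  have lim: "f \<longlonglongrightarrow> 1 / real (k + 1)"
  proof (cases "c = b")
    case True
    have "(\<lambda>q. (real q - real j) / ((real k + 1) * real q - real l)) \<longlonglongrightarrow> 1 / real (k + 1)"
      using k by (real_asymp simp: field_simps)
    moreover have "\<forall>\<^sub>F q in sequentially.
        (real q - real j) / ((real k + 1) * real q - real l) = f q"
      using eventually_ge_at_top[of l]
    proof eventually_elim
      case (elim q)
      then have "l \<le> (k + 1) * q" "j \<le> q" using jl by (auto intro: order_trans)
      then show ?case using True by (simp only: f_def if_True of_nat_diff) (simp add: algebra_simps)
    qed
    ultimately show ?thesis by (rule Lim_transform_eventually)
  next
    case False
    have "(\<lambda>q. (real k * real q - real l + real j) / (real k * ((real k + 1) * real q - real l)))
       \<longlonglongrightarrow> real k * (inverse (real k) * inverse (real k + 1))"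
      using k by real_asymp
    moreover have "real k * (inverse (real k) * inverse (real k + 1)) = 1 / real (k + 1)"
      using k by (simp add: divide_inverse flip: mult.assoc)
    ultimately have "(\<lambda>q. (real k * real q - real l + real j) /
        (real k * ((real k + 1) * real q - real l))) \<longlonglongrightarrow> 1 / real (k + 1)"
      by simp
    moreover have "\<forall>\<^sub>F q in sequentially.
        (real k * real q - real l + real j) / (real k * ((real k + 1) * real q - real l)) = f q"
      using eventually_ge_at_top[of l]
    proof eventually_elim
      case (elim q)
      have "l \<le> k * q" using k elim by (cases k) auto
      then have "l \<le> (k + 1) * q" "j \<le> q" "q - j \<le> (k + 1) * q - l"
        using jl elim by auto
      then show ?case using False
        by (simp only: f_def if_False of_nat_diff) (simp add: algebra_simps)
    qed
    ultimately show ?thesis by (rule Lim_transform_eventually)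
  qed
  have step: "?h (c # z) q = f q * ?h z q" if q: "q > l" for q
  proof -
    have "q \<le> k * q" using k by (cases k) auto
    then obtain N where N: "(k + 1) * q - l = Suc N"
      using q by (cases "(k + 1) * q - l") auto
    then have N': "(k + 1) * q - length (c # z) = N" by (simp add: l_def)
    obtain p where p: "q - j = Suc p" using q jl by (cases "q - j") auto
    have "k * q + q - l = Suc N" using N by (simp add: algebra_simps)
    then have le: "q - j \<le> N" using q jl \<open>q \<le> k * q\<close> by linarith
    show ?thesis
    proof (cases "c = b")
      case True
      then have "q - count_list (c # z) b = p" using p by (simp add: j_def)
      moreover have "card (words_with_count A b N p) * Suc N
          = card (words_with_count A b (Suc N) (Suc p)) * Suc p"
        using card_words_with_count_drop_symbol[OF assms(1,2)] le p by simp
      then have "real (card (words_with_count A b N p)) * real (Suc N)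
          = real (card (words_with_count A b (Suc N) (Suc p))) * real (Suc p)"
        by (metis of_nat_mult)
      ultimately show ?thesis
        using True N' N p unfolding f_def by (simp add: l_def j_def field_simps)
    next
      case False
      then have "q - count_list (c # z) b = q - j" by (simp add: j_def)
      moreover have "card (words_with_count A b N (q - j)) * (Suc N * k)
          = card (words_with_count A b (Suc N) (q - j)) * (Suc N - (q - j))"
        unfolding k_def by (rule card_words_with_count_drop_letter[OF assms(1,2) le])
      then have "real (card (words_with_count A b N (q - j))) * (real (Suc N) * real k)
          = real (card (words_with_count A b (Suc N) (q - j))) * real (Suc N - (q - j))"
        by (metis of_nat_mult)
      ultimately show ?thesis
        using False N' N k unfolding f_def l_def[symmetric] j_def[symmetric]
        by (simp add: field_simps del: of_nat_Suc)
    qed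
  qed
  have "(\<lambda>q. f q * (?h z q / real (card (words_with_count A b ((k + 1) * q) q))))
      \<longlonglongrightarrow> 1 / real (k + 1) * (1 / real (k + 1) ^ length z)"
    using Cons by (intro tendsto_mult lim) auto
  moreover have "\<forall>\<^sub>F q in sequentially.
      f q * (?h z q / real (card (words_with_count A b ((k + 1) * q) q)))
      = ?h (c # z) q / real (card (words_with_count A b ((k + 1) * q) q))"
    using eventually_gt_at_top[of l] by eventually_elim (simp only: step times_divide_eq_right)
  ultimately show ?case by (auto intro: Lim_transform_eventually)
qed

section \<open>Insertion with a fixed block length\<close>

text \<open>Between neighbouring multiples of \<open>d\<close> the function \<open>F\<close> changes by at most \<open>d\<close>, which is
  negligible after division by \<open>n\<close>.\<close>
lemma tendsto_div_of_multiples: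
  fixes F :: "nat \<Rightarrow> real"
  assumes "d > 0"
    and step: "\<And>m n. m \<le> n \<Longrightarrow> \<bar>F n - F m\<bar> \<le> real (n - m)"
    and lim: "(\<lambda>T. F (d * T) / real (d * T)) \<longlonglongrightarrow> c"
  shows "(\<lambda>n. F n / real n) \<longlonglongrightarrow> c"
proof -
  define r where "r n = d * (n div d)" for n
  have r: "r n \<le> n" "n - r n \<le> d" for n
    using assms(1) by (simp_all add: r_def minus_mult_div_eq_mod less_imp_le)
  have dn: "(\<lambda>n. real d / real n) \<longlonglongrightarrow> 0"
    by (rule lim_const_over_n)
  have div_top: "filterlim (\<lambda>n. n div d) at_top sequentially"
    unfolding filterlim_at_top
  proof
    fix Z show "\<forall>\<^sub>F n in sequentially. Z \<le> n div d"
      using eventually_ge_at_top[of "Z * d"]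
      by eventually_elim (use assms(1) in \<open>simp add: less_eq_div_iff_mult_less_eq\<close>)
  qed
  have 1: "(\<lambda>n. F (r n) / real (r n)) \<longlonglongrightarrow> c"
    unfolding r_def using filterlim_compose[OF lim div_top] .
  have "(\<lambda>n. real (r n) / real n - 1) \<longlonglongrightarrow> 0"
  proof (rule tendsto_0_le[OF dn, where K = 1])
    show "\<forall>\<^sub>F n in sequentially. norm (real (r n) / real n - 1) \<le> norm (real d / real n) * 1"
      using eventually_gt_at_top[of 0]
    proof eventually_elim
      case (elim n)
      have "\<bar>real (r n) - real n\<bar> \<le> real d" using r[of n] by simp
      then have "\<bar>real (r n) - real n\<bar> / real n \<le> real d / real n" by (rule divide_right_mono) simp
      moreover have "real (r n) / real n - 1 = (real (r n) - real n) / real n"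
        using elim by (simp add: diff_divide_distrib)
      ultimately show ?case by simp
    qed
  qed
  then have 2: "(\<lambda>n. real (r n) / real n) \<longlonglongrightarrow> 1" by (rule LIM_zero_cancel)
  have 3: "(\<lambda>n. (F n - F (r n)) / real n) \<longlonglongrightarrow> 0"
  proof (rule tendsto_0_le[OF dn, where K = 1])
    show "\<forall>\<^sub>F n in sequentially. norm ((F n - F (r n)) / real n) \<le> norm (real d / real n) * 1"
    proof (intro always_eventually allI)
      fix n
      have "\<bar>F n - F (r n)\<bar> \<le> real d" using step[OF r(1)[of n]] r(2)[of n] by linarith
      then show "norm ((F n - F (r n)) / real n) \<le> norm (real d / real n) * 1"
        by (simp add: divide_right_mono)
    qed
  qed
  have "(\<lambda>n. F (r n) / real (r n) * (real (r n) / real n) + (F n - F (r n)) / real n)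
      \<longlonglongrightarrow> c * 1 + 0"
    by (intro tendsto_intros 1 2 3)
  moreover have "\<forall>\<^sub>F n in sequentially.
      F (r n) / real (r n) * (real (r n) / real n) + (F n - F (r n)) / real n = F n / real n"
    using eventually_ge_at_top[of d]
  proof eventually_elim
    case (elim n)
    then have "r n > 0" using assms(1) by (simp add: r_def div_greater_zero_iff)
    then show ?case by (simp add: diff_divide_distrib)
  qed
  ultimately show ?thesis by (auto intro: Lim_transform_eventually)
qed

lemma hits_block_superblock:
  "hits (block l X) z (d * T)
     = (\<Sum>t<T. hits (\<lambda>e. take l (drop (e * l) (block (d * l) X t))) z d)"
proof (induction T)
  case (Suc T)
  have "block l X (d * T + e) = take l (drop (e * l) (block (d * l) X T))" if "e < d" for e
  proof -
    have "Suc e * l \<le> d * l" using that by (intro mult_le_mono1) simp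
    then show ?thesis
      by (simp add: block_def drop_map take_map take_upt algebra_simps)
  qed
  then have "hits (\<lambda>e. block l X (d * T + e)) z d
      = hits (\<lambda>e. take l (drop (e * l) (block (d * l) X T))) z d"
    by (intro hits_cong) auto
  then show ?case using Suc hits_add[of "block l X" z "d * T" d] by (simp add: add.commute)
qed simp

lemma hits_eq_sum: "hits f a n = (\<Sum>t<n. if f t = a then 1 else 0)"
  by (induction n) (simp_all add: hits_Suc)

text \<open>
  Round robin over the expansions of the blocks of \<open>v\<close>. The word \<open>X\<close> visits each element of the
  set \<open>\<Omega>\<close> of balanced blocks with the same frequency \<open>1 / |\<Omega>|\<close>. When \<open>|z|\<close> divides the block
  length, an aligned occurrence of \<open>z\<close> lies inside a single block, so the frequency of \<open>z\<close> is an
  average over \<open>\<Omega>\<close> and over the window positions in a block.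
\<close>
lemma balanced_insertion:
  assumes A: "finite A" "b \<notin> A" "A \<noteq> {}" and q: "q \<ge> 1"
    and v: "range v \<subseteq> A" and normal: "simply_normal_to_length A (card A * q) v"
  defines "k \<equiv> card A"
  shows "\<exists>X. range X \<subseteq> insert b A \<and>
    (\<forall>t. filter (\<lambda>c. c \<noteq> b) (block ((k + 1) * q) X t) = block (k * q) v t) \<and>
    (\<forall>z. z \<noteq> [] \<longrightarrow> length z dvd (k + 1) * q \<longrightarrow> set z \<subseteq> insert b A \<longrightarrow> count_list z b \<le> q \<longrightarrow>
      (\<lambda>n. real (hits (block (length z) X) z n) / real n) \<longlonglongrightarrow>
        real (card (words_with_count A b ((k + 1) * q - length z) (q - count_list z b)))
            / real (card (words_with_count A b ((k + 1) * q) q)))"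
proof -
  define K L where "K = (k + 1) * q" and "L = k * q"
  have k: "k > 0" using A by (simp add: k_def card_gt_0_iff)
  have KL: "K = L + q" "K > 0" "L \<ge> 1" using k q by (auto simp: K_def L_def)
  define u where "u = block L v"
  define D where "D = {a. set a \<subseteq> A \<and> length a = L}"
  define \<Omega> where "\<Omega> = words_with_count A b K q"
  define M where "M = K choose L"
  have uD: "u t \<in> D" for t using v by (auto simp: u_def D_def block_def)
  have ins: "finite (insertions b K a)" "card (insertions b K a) = M" if "a \<in> D" for a
    using card_insertions[of b a K] that A(2) by (auto simp: D_def M_def)
  have M: "M > 0" using KL by (simp add: M_def)
  have ne: "insertions b K a \<noteq> {}" if "a \<in> D" for a using ins[OF that] M by auto
  obtain w where w: "\<And>t. w t \<in> insertions b K (u t)"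
    and rr: "\<And>a c T. a \<in> D \<Longrightarrow> c \<in> insertions b K a \<Longrightarrow>
      \<bar>real (hits (\<lambda>t. (u t, w t)) (a, c) T)
        - real (hits u a T) / real (card (insertions b K a))\<bar> \<le> 1"
    using round_robin[of u D "insertions b K", OF uD ins(1) ne] by blast
  have lw: "length (w t) = K" and fw: "filter (\<lambda>c. c \<noteq> b) (w t) = u t" for t
    using w[of t] by (auto simp: insertions_def)
  define X where "X i = w (i div K) ! (i mod K)" for i
  have blockX: "block K X t = w t" for t
    by (rule nth_equalityI) (auto simp: block_def lw X_def)
  have w\<Omega>: "w t \<in> \<Omega>" for t
  proof -
    have "set (filter (\<lambda>c. c \<noteq> b) (w t)) \<subseteq> A" "length (filter (\<lambda>c. c \<noteq> b) (w t)) = L"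
      using uD[of t] by (auto simp: fw D_def)
    then show ?thesis using length_filter_neq[of b "w t"] KL
      by (auto simp: \<Omega>_def words_with_count_def lw)
  qed
  have "range X \<subseteq> insert b A"
  proof
    fix c assume "c \<in> range X"
    then obtain i where "c = w (i div K) ! (i mod K)" by (auto simp: X_def)
    then have "c \<in> set (w (i div K))" using KL by (simp add: lw)
    then show "c \<in> insert b A" using w\<Omega>[of "i div K"] by (auto simp: \<Omega>_def words_with_count_def)
  qed
  moreover have "\<forall>t. filter (\<lambda>c. c \<noteq> b) (block K X t) = block L v t"
    by (simp add: blockX fw u_def)
  moreover have card\<Omega>: "card \<Omega> = M * k ^ L"
    using card_words_with_count[of A b q K] A KL binomial_symmetric[of q K]
    by (simp add: \<Omega>_def M_def k_def)
  have fin\<Omega>: "finite \<Omega>" using A by (simp add: \<Omega>_def finite_words_with_count)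
  (* A balanced block c determines the block a of v that it expands, so c is hit exactly when the
     pair (a, c) is. *)
  have freq: "(\<lambda>T. real (hits w c T) / real T) \<longlonglongrightarrow> 1 / real (card \<Omega>)" if c: "c \<in> \<Omega>" for c
  proof -
    define a where "a = filter (\<lambda>c. c \<noteq> b) c"
    have a: "a \<in> D" "c \<in> insertions b K a"
      using c length_filter_neq[of b c] KL
      by (auto simp: a_def D_def \<Omega>_def words_with_count_def insertions_def)
    have "hits w c T = hits (\<lambda>t. (u t, w t)) (a, c) T" for T
      unfolding hits_def by (rule arg_cong[of _ _ card]) (auto simp: a_def fw)
    then have bound: "\<bar>real (hits w c T) - real (hits u a T) / real M\<bar> \<le> 1" for T
      using rr[OF a] ins(2)[OF a(1)] by simp
    have "(\<lambda>T. real (hits u a T) / real T) \<longlonglongrightarrow> 1 / real k ^ L"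
      using normal a(1) KL(3) simply_normal_iff_hits[of L A v]
      by (auto simp: u_def D_def k_def L_def)
    then have 1: "(\<lambda>T. real (hits u a T) / real T / real M) \<longlonglongrightarrow> 1 / real k ^ L / real M"
      by (rule tendsto_divide) (use M in auto)
    have 2: "(\<lambda>T. (real (hits w c T) - real (hits u a T) / real M) / real T) \<longlonglongrightarrow> 0"
    proof (rule tendsto_0_le[OF lim_const_over_n[of 1], where K = 1], intro always_eventually allI)
      fix T
      show "norm ((real (hits w c T) - real (hits u a T) / real M) / real T) \<le> norm (1 / real T) * 1"
        using divide_right_mono[OF bound[of T], of "real T"] by simp
    qed
    have "(\<lambda>T. real (hits u a T) / real T / real M +
        (real (hits w c T) - real (hits u a T) / real M) / real T) \<longlonglongrightarrow> 1 / real k ^ L / real M + 0"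
      by (rule tendsto_add[OF 1 2])
    moreover have "real (hits u a T) / real T / real M +
        (real (hits w c T) - real (hits u a T) / real M) / real T = real (hits w c T) / real T" for T
      by (simp add: diff_divide_distrib mult.commute)
    ultimately show ?thesis by (simp add: card\<Omega> mult.commute)
  qed
  have "(\<lambda>n. real (hits (block (length z) X) z n) / real n) \<longlonglongrightarrow>
        real (card (words_with_count A b (K - length z) (q - count_list z b))) / real (card \<Omega>)"
    if z: "z \<noteq> []" "length z dvd K" "set z \<subseteq> insert b A" "count_list z b \<le> q" for z
  proof -
    let ?l = "length z" and ?W = "card (words_with_count A b (K - length z) (q - count_list z b))"
    obtain d where d: "K = d * ?l" using z(2) by (auto simp: dvd_def mult.commute)
    have d0: "d > 0" using d KL(2) by (cases d) auto
    define occ where "occ c = hits (\<lambda>e. take ?l (drop (e * ?l) c)) z d" for c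
    (* Exchanging the sums counts, for each window position e, the balanced blocks with z there;
       this number does not depend on e. *)
    have "(\<Sum>c\<in>\<Omega>. occ c) = (\<Sum>e<d. \<Sum>c\<in>\<Omega>. if take ?l (drop (e * ?l) c) = z then 1 else 0)"
      unfolding occ_def hits_eq_sum by (rule sum.swap)
    also have "\<dots> = (\<Sum>e<d. ?W)"
    proof (rule sum.cong)
      fix e assume "e \<in> {..<d}"
      then have "Suc e * ?l \<le> d * ?l" by (intro mult_le_mono1) auto
      then have le: "e * ?l + ?l \<le> K" using d by simp
      have "(\<Sum>c\<in>\<Omega>. if take ?l (drop (e * ?l) c) = z then 1 else 0)
          = card {c \<in> \<Omega>. take ?l (drop (e * ?l) c) = z}"
        using fin\<Omega> by (simp add: sum.If_cases Int_def)
      also have "\<dots> = ?W"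
        unfolding \<Omega>_def by (rule card_words_with_count_window[OF z(3) le z(4)])
      finally show "(\<Sum>c\<in>\<Omega>. if take ?l (drop (e * ?l) c) = z then 1 else 0) = ?W" .
    qed simp
    finally have sum_occ: "(\<Sum>c\<in>\<Omega>. occ c) = d * ?W" by simp
    have count: "hits (block ?l X) z (d * T) = (\<Sum>c\<in>\<Omega>. hits w c T * occ c)" for T
    proof -
      have "hits (block ?l X) z (d * T) = (\<Sum>t<T. occ (w t))"
        using hits_block_superblock[of ?l X z d T] by (simp add: occ_def flip: d blockX)
      also have "\<dots> = (\<Sum>c\<in>\<Omega>. hits w c T * occ c)"
        by (rule sum_by_value[OF fin\<Omega> w\<Omega>])
      finally show ?thesis .
    qed
    have "(\<lambda>T. (\<Sum>c\<in>\<Omega>. real (hits w c T) / real T * (real (occ c) / real d)))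
        \<longlonglongrightarrow> (\<Sum>c\<in>\<Omega>. 1 / real (card \<Omega>) * (real (occ c) / real d))"
      by (intro tendsto_sum tendsto_mult freq tendsto_const)
    also have "(\<Sum>c\<in>\<Omega>. 1 / real (card \<Omega>) * (real (occ c) / real d))
        = real (\<Sum>c\<in>\<Omega>. occ c) / real d / real (card \<Omega>)"
      by (simp add: sum_divide_distrib mult.commute)
    also have "\<dots> = real ?W / real (card \<Omega>)" using d0 by (simp add: sum_occ)
    also have "(\<lambda>T. (\<Sum>c\<in>\<Omega>. real (hits w c T) / real T * (real (occ c) / real d)))
        = (\<lambda>T. real (hits (block ?l X) z (d * T)) / real (d * T))"
      unfolding count by (simp add: sum_divide_distrib mult.commute)
    finally have "(\<lambda>T. real (hits (block ?l X) z (d * T)) / real (d * T))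
        \<longlonglongrightarrow> real ?W / real (card \<Omega>)" .
    then show ?thesis
    proof (rule tendsto_div_of_multiples[OF d0, rotated])
      fix m n :: nat assume "m \<le> n"
      then show "\<bar>real (hits (block ?l X) z n) - real (hits (block ?l X) z m)\<bar> \<le> real (n - m)"
        using hits_add[of "block ?l X" z m "n - m"]
          hits_le[of "\<lambda>e. block ?l X (m + e)" z "n - m"] by simp
    qed
  qed
  ultimately show ?thesis unfolding K_def L_def \<Omega>_def by blast
qed

section \<open>Splicing words with increasing block lengths\<close>

text \<open>
  Here \<open>f\<close> and \<open>g s\<close> stand for the discrepancy, the count of a word minus its expected value, of the
  spliced word and of the word followed in stage \<open>s\<close>. Before stage \<open>s\<close> nothing is known beyond the
  trivial bound, but by growth its start \<open>\<nu> s\<close> is at most \<open>\<nu> (Suc s) / s\<close>. Hence in stage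
  \<open>Suc s\<close> the discrepancy relative to \<open>n\<close> is at most \<open>1 / s\<close> for all that precedes stage \<open>s\<close>, plus
  \<open>2 * \<epsilon>\<close> for each of the two stages, once at either end.
\<close>
lemma splice_discrepancy:
  fixes f :: "nat \<Rightarrow> real" and g :: "nat \<Rightarrow> nat \<Rightarrow> real" and \<nu> :: "nat \<Rightarrow> nat"
  assumes trivial: "\<And>n. \<bar>f n\<bar> \<le> real n"
    and agree: "\<And>s n. start \<le> s \<Longrightarrow> \<nu> s \<le> n \<Longrightarrow> n \<le> \<nu> (Suc s) \<Longrightarrow> f n - f (\<nu> s) = g s n - g s (\<nu> s)"
    and small: "\<And>s n. start \<le> s \<Longrightarrow> \<nu> s \<le> n \<Longrightarrow> \<bar>g s n\<bar> \<le> \<epsilon> s * real n"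
    and growth: "\<And>s. start \<le> s \<Longrightarrow> s * \<nu> s \<le> \<nu> (Suc s)"
    and mono: "\<And>s. start \<le> s \<Longrightarrow> \<nu> s < \<nu> (Suc s)"
    and \<epsilon>: "\<epsilon> \<longlonglongrightarrow> 0" "\<And>s. \<epsilon> s \<ge> 0"
  shows "(\<lambda>n. f n / real n) \<longlonglongrightarrow> 0"
proof -
  define \<delta> where "\<delta> s = 1 / real s + 2 * \<epsilon> s + 2 * \<epsilon> (Suc s)" for s
  have stage: "\<bar>f n\<bar> \<le> \<bar>f (\<nu> s)\<bar> + 2 * \<epsilon> s * real n"
    if "start \<le> s" "\<nu> s \<le> n" "n \<le> \<nu> (Suc s)" for s n
  proof -
    have "\<bar>g s (\<nu> s)\<bar> \<le> \<epsilon> s * real (\<nu> s)" using small that by simp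
    also have "\<dots> \<le> \<epsilon> s * real n" using that \<epsilon>(2) by (intro mult_left_mono) auto
    finally show ?thesis using agree[OF that] small[OF that(1,2)] by linarith
  qed
  have bound: "\<bar>f n\<bar> \<le> \<delta> s * real n"
    if s: "start \<le> s" "s \<ge> 1" "\<nu> (Suc s) \<le> n" "n \<le> \<nu> (Suc (Suc s))" for s n
  proof -
    have "real s * real (\<nu> s) \<le> real (\<nu> (Suc s))"
      using growth[OF s(1)] by (metis of_nat_le_iff of_nat_mult)
    then have 1: "real (\<nu> s) \<le> real n / real s" using s by (simp add: field_simps)
    have "\<bar>f (\<nu> (Suc s))\<bar> \<le> real (\<nu> s) + 2 * \<epsilon> s * real (\<nu> (Suc s))"
      using stage[of s "\<nu> (Suc s)"] trivial[of "\<nu> s"] s mono[OF s(1)] by simp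
    also have "\<dots> \<le> real n / real s + 2 * \<epsilon> s * real n"
      using 1 s \<epsilon>(2) by (intro add_mono mult_left_mono) auto
    finally show ?thesis using stage[of "Suc s" n] s by (simp add: \<delta>_def algebra_simps)
  qed
  have "\<delta> \<longlonglongrightarrow> 0 + 2 * 0 + 2 * 0"
    unfolding \<delta>_def using \<epsilon>(1)
    by (intro tendsto_intros lim_const_over_n) (simp_all add: filterlim_sequentially_Suc)
  then have \<delta>: "\<delta> \<longlonglongrightarrow> 0" by simp
  show ?thesis
  proof (rule LIMSEQ_I)
    fix r :: real assume r: "r > 0"
    obtain S0 where S0: "\<And>s. s \<ge> S0 \<Longrightarrow> \<delta> s < r"
      using LIMSEQ_D[OF \<delta> r] by fastforce
    define S where "S = Max {S0, start, 1}"
    have S: "S \<ge> S0" "S \<ge> start" "S \<ge> 1" by (auto simp: S_def)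
    have locate: "\<exists>s\<ge>S. \<nu> (Suc s) \<le> n \<and> n < \<nu> (Suc (Suc s))" if "\<nu> (Suc S) \<le> n" for n
      using that
    proof (induction n rule: nat_induct_at_least)
      case base
      then show ?case using mono[of "Suc S"] S by auto
    next
      case (Suc n)
      then obtain s where s: "s \<ge> S" "\<nu> (Suc s) \<le> n" "n < \<nu> (Suc (Suc s))" by auto
      show ?case
      proof (cases "Suc n < \<nu> (Suc (Suc s))")
        case True
        then show ?thesis using s by (intro exI[of _ s]) auto
      next
        case False
        then show ?thesis using s mono[of "Suc (Suc s)"] S
          by (intro exI[of _ "Suc s"]) auto
      qed
    qed
    have "norm (f n / real n - 0) < r" if n: "n \<ge> Suc (\<nu> (Suc S))" for n
    proof -
      obtain s where s: "s \<ge> S" "\<nu> (Suc s) \<le> n" "n < \<nu> (Suc (Suc s))"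
        using locate[of n] n by auto
      have "\<bar>f n\<bar> \<le> \<delta> s * real n" using bound[of s n] s S by auto
      also have "\<dots> < r * real n" using S0[of s] s S n by (intro mult_strict_right_mono) auto
      finally show ?thesis using n by (simp add: field_simps)
    qed
    then show "\<exists>no. \<forall>n\<ge>no. norm (f n / real n - 0) < r" by blast
  qed
qed

text \<open>
  Divisibility makes every boundary a block boundary for both adjacent stages; \<open>Suc s * N s\<close> gives the
  growth required for splicing; and \<open>Th s\<close> is the number of blocks, of length at most \<open>s\<close>, after
  which the word of stage \<open>s\<close> has settled.
\<close>
lemma stage_boundaries:
  fixes Th :: "nat \<Rightarrow> nat" and k :: nat
  shows "\<exists>N. N 0 = 0 \<and> (\<forall>s. (k + 1) * fact s dvd N s \<and> (k + 1) * fact s dvd N (Suc s) \<and>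
    N s < N (Suc s) \<and> Suc s * N s \<le> N (Suc s) \<and> Suc s * Th (Suc s) \<le> N (Suc s))"
proof -
  define N where "N = rec_nat 0 (\<lambda>s n. (k + 1) * fact (Suc s) * (Suc s * (n + Th (Suc s)) + 1))"
  have N0: "N 0 = 0" by (simp add: N_def)
  have NS: "N (Suc s) = (k + 1) * fact (Suc s) * (Suc s * (N s + Th (Suc s)) + 1)" for s
    by (simp add: N_def)
  have dvdS: "(k + 1) * fact (Suc s) dvd N (Suc s)" for s unfolding NS by (rule dvd_triv_left)
  have dvd: "(k + 1) * fact s dvd N s" for s using dvdS N0 by (cases s) auto
  have "(k + 1) * fact s dvd (k + 1) * (fact (Suc s) :: nat)" for s
    by (intro mult_dvd_mono fact_dvd) auto
  then have dvd': "(k + 1) * fact s dvd N (Suc s)" for s using dvdS dvd_trans by blast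
  have ge: "Suc s * (N s + Th (Suc s)) + 1 \<le> N (Suc s)" for s
  proof -
    have "0 < (k + 1) * (fact (Suc s) :: nat)" by (simp del: fact_Suc)
    then have "1 \<le> (k + 1) * (fact (Suc s) :: nat)" by (simp only: Suc_le_eq One_nat_def)
    then have "1 * (Suc s * (N s + Th (Suc s)) + 1) \<le> N (Suc s)"
      unfolding NS by (rule mult_le_mono1)
    then show ?thesis by simp
  qed
  have "N s < N (Suc s) \<and> Suc s * N s \<le> N (Suc s) \<and> Suc s * Th (Suc s) \<le> N (Suc s)" for s
    using ge[of s] by (auto simp: algebra_simps)
  then show ?thesis using N0 dvd dvd' by blast
qed

lemma splice_exists:
  fixes N :: "nat \<Rightarrow> nat" and X :: "nat \<Rightarrow> 'a word"
  assumes "strict_mono N" "N 0 = 0"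
  shows "\<exists>x. (\<forall>s i. N s \<le> i \<longrightarrow> i < N (Suc s) \<longrightarrow> x i = X s i) \<and> range x \<subseteq> (\<Union>s. range (X s))"
proof -
  define x where "x i = X (LEAST s. i < N (Suc s)) i" for i
  have "x i = X s i" if "N s \<le> i" "i < N (Suc s)" for s i
  proof -
    have "(LEAST s. i < N (Suc s)) = s"
    proof (rule Least_equality)
      fix y assume "i < N (Suc y)"
      then have "N s < N (Suc y)" using that by simp
      then show "s \<le> y" using strict_mono_less[OF assms(1)] by simp
    qed (use that in simp)
    then show ?thesis by (simp add: x_def)
  qed
  then show ?thesis by (intro exI[of _ x]) (auto simp: x_def)
qed

section \<open>Deleting the inserted symbol\<close>

lemma filter_concat_blocks:
  assumes "\<And>t. filter P (block K X t) = block L v t" "s \<le> t"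
  shows "filter P (map X [s * K..<t * K]) = map v [s * L..<t * L]"
  using assms(2)
proof (induction t rule: dec_induct)
  case (step t)
  have split: "[s * m..<Suc t * m] = [s * m..<t * m] @ [t * m..<t * m + m]" for m
    using step(1) upt_add_eq_append[of "s * m" "t * m" m] by (simp add: add.commute mult_le_mono1)
  show ?case using step assms(1)[of t] by (simp only: split map_append filter_append block_def)
qed simp

text \<open>Finite prefixes already determine the enumeration of the surviving positions; this reduces
  deletion from infinite words to \<open>filter\<close> on arbitrarily long prefixes.\<close>
lemma filter_upt_nth_enumerate:
  assumes "infinite S" "n < length (filter (\<lambda>i. i \<in> S) [0..<N])"
  shows "filter (\<lambda>i. i \<in> S) [0..<N] ! n = enumerate S n"
  using assms(2)
proof (induction N)
  case (Suc N)
  show ?case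
  proof (cases "n < length (filter (\<lambda>i. i \<in> S) [0..<N])")
    case False
    then have NS: "N \<in> S" and n: "n = length (filter (\<lambda>i. i \<in> S) [0..<N])"
      using Suc.prems by (auto split: if_splits)
    obtain m where m: "enumerate S m = N" using enumerate_Ex[OF assms(1) NS] by auto
    have "{i. i < N \<and> i \<in> S} = enumerate S ` {..<m}"
    proof (intro equalityI subsetI)
      fix i assume i: "i \<in> {i. i < N \<and> i \<in> S}"
      then obtain j where "enumerate S j = i" using enumerate_Ex[OF assms(1)] by blast
      then show "i \<in> enumerate S ` {..<m}" using i m assms(1) by auto
    qed (use m assms(1) in \<open>auto simp: enumerate_in_set\<close>)
    moreover have "inj_on (enumerate S) {..<m}"
      using inj_enumerate[OF assms(1)] by (rule inj_on_subset) simp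
    moreover have "n = card {i. i < N \<and> i \<in> S}"
      unfolding n using length_filter_conv_card[of "\<lambda>i. i \<in> S" "[0..<N]"]
      by (simp cong: conj_cong)
    ultimately have "n = m" by (simp add: card_image)
    then show ?thesis using m n NS by (simp add: nth_append)
  qed (use Suc in \<open>simp add: nth_append\<close>)
qed simp

lemma delete_symbol_eqI:
  assumes "\<And>m. \<exists>N M. m \<le> M \<and> filter (\<lambda>c. c \<noteq> b) (map x [0..<N]) = map v [0..<M]"
  shows "delete_symbol b (InfWord x) = InfWord v"
proof -
  define S where "S = {i. x i \<noteq> b}"
  have fm: "filter (\<lambda>c. c \<noteq> b) (map x [0..<N]) = map x (filter (\<lambda>i. i \<in> S) [0..<N])" for N
    by (simp add: filter_map o_def S_def)
  have inf: "infinite S"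
  proof
    assume fin: "finite S"
    obtain N M where NM: "Suc (card S) \<le> M"
        "filter (\<lambda>c. c \<noteq> b) (map x [0..<N]) = map v [0..<M]"
      using assms by blast
    have "M = length (filter (\<lambda>i. i \<in> S) [0..<N])"
      using arg_cong[OF NM(2), of length] by (simp only: fm length_map) simp
    also have "\<dots> = card (set (filter (\<lambda>i. i \<in> S) [0..<N]))"
      by (rule distinct_card[symmetric]) simp
    also have "\<dots> \<le> card S" by (intro card_mono fin) auto
    finally show False using NM by simp
  qed
  have "x (enumerate S n) = v n" for n
  proof -
    obtain N M where NM: "Suc n \<le> M" "filter (\<lambda>c. c \<noteq> b) (map x [0..<N]) = map v [0..<M]"
      using assms by blast
    then have eq: "map x (filter (\<lambda>i. i \<in> S) [0..<N]) = map v [0..<M]" by (simp only: fm)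
    then have "length (filter (\<lambda>i. i \<in> S) [0..<N]) = M" by (metis length_map diff_zero length_upt)
    then show ?thesis
      using NM(1) arg_cong[OF eq, of "\<lambda>l. l ! n"] filter_upt_nth_enumerate[OF inf, of n N] by simp
  qed
  then show ?thesis using inf by (simp add: S_def)
qed

section \<open>Extending a normal word by a new symbol\<close>

text \<open>
  Stage \<open>s\<close> uses the block parameter \<open>q = s!\<close>: every length \<open>l\<close> divides it as soon as \<open>s \<ge> l\<close>, so
  that occurrences aligned to \<open>l\<close> respect the stage boundaries, and \<open>s!\<close> divides \<open>(s + 1)!\<close>, so that
  consecutive stages have block boundaries in common.
\<close>
theorem normal_word_by_insertion:
  assumes A: "finite A" "b \<notin> A" "A \<noteq> {}" and v: "range v \<subseteq> A" and normal: "normal_word A v"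
  shows "\<exists>x. range x \<subseteq> insert b A \<and> normal_word (insert b A) x \<and>
    delete_symbol b (InfWord x) = InfWord v"
proof -
  define k where "k = card A"
  have k: "k > 0" using A by (simp add: k_def card_gt_0_iff)
  define \<rho> where "\<rho> z q = real (card (words_with_count A b ((k + 1) * q - length z) (q - count_list z b)))
            / real (card (words_with_count A b ((k + 1) * q) q))" for z and q :: nat
  define balanced where "balanced s X \<longleftrightarrow> range X \<subseteq> insert b A \<and>
    (\<forall>t. filter (\<lambda>c. c \<noteq> b) (block ((k + 1) * fact s) X t) = block (k * fact s) v t) \<and>
    (\<forall>z. z \<noteq> [] \<longrightarrow> length z dvd (k + 1) * fact s \<longrightarrow> set z \<subseteq> insert b A \<longrightarrow>
      count_list z b \<le> fact s \<longrightarrow>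
      (\<lambda>n. real (hits (block (length z) X) z n) / real n) \<longlonglongrightarrow> \<rho> z (fact s))" for s X
  have "\<exists>X. balanced s X" for s
  proof -
    have "k * fact s \<ge> 1" using k by (simp add: Suc_le_eq)
    then have "simply_normal_to_length A (card A * fact s) v"
      using normal by (simp add: normal_word_def k_def)
    then show ?thesis
      using balanced_insertion[OF A fact_ge_1 v] unfolding balanced_def \<rho>_def k_def by blast
  qed
  then obtain X where X: "\<And>s. balanced s (X s)" by metis
  have X_range: "range (X s) \<subseteq> insert b A" for s
    using X[of s] by (simp add: balanced_def)
  have X_filter: "filter (\<lambda>c. c \<noteq> b) (block ((k + 1) * fact s) (X s) t) = block (k * fact s) v t"
    for s t
    using X[of s] by (simp only: balanced_def)
  have X_freq: "(\<lambda>n. real (hits (block (length z) (X s)) z n) / real n) \<longlonglongrightarrow> \<rho> z (fact s)"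
    if "z \<noteq> []" "length z dvd (k + 1) * fact s" "set z \<subseteq> insert b A" "count_list z b \<le> fact s"
    for s z
    using X[of s] that unfolding balanced_def by blast
  define Z where "Z s = {z. set z \<subseteq> insert b A \<and> length z \<le> s \<and> z \<noteq> []}" for s
  have finZ: "finite (Z s)" for s
    by (rule finite_subset[OF _ finite_lists_length_le[of "insert b A" s]])
      (use A in \<open>auto simp: Z_def\<close>)
  (* Only finitely many words have length at most s, so one threshold serves them all. *)
  have "\<exists>m. \<forall>n\<ge>m. \<forall>z\<in>Z s. \<bar>real (hits (block (length z) (X s)) z n) / real n - \<rho> z (fact s)\<bar>
      < 1 / real (Suc s)" for s
  proof -
    have "\<forall>\<^sub>F n in sequentially. \<forall>z\<in>Z s.
      \<bar>real (hits (block (length z) (X s)) z n) / real n - \<rho> z (fact s)\<bar> < 1 / real (Suc s)"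
    proof (rule eventually_ball_finite[OF finZ], intro ballI)
      fix z assume z: "z \<in> Z s"
      have "length z dvd fact s" using z by (intro dvd_fact) (auto simp: Z_def Suc_le_eq)
      moreover have "count_list z b \<le> fact s"
        using length_filter_neq[of b z] z fact_ge_self[of s] by (simp add: Z_def)
      ultimately have "(\<lambda>n. real (hits (block (length z) (X s)) z n) / real n) \<longlonglongrightarrow> \<rho> z (fact s)"
        using z by (intro X_freq) (auto simp: Z_def)
      then show "\<forall>\<^sub>F n in sequentially.
          \<bar>real (hits (block (length z) (X s)) z n) / real n - \<rho> z (fact s)\<bar> < 1 / real (Suc s)"
        by (auto dest!: tendstoD[where e = "1 / real (Suc s)"] simp: dist_real_def)
    qed
    then show ?thesis by (simp add: eventually_sequentially)
  qed
  then obtain Th where Th: "\<And>s n z. Th s \<le> n \<Longrightarrow> z \<in> Z s \<Longrightarrow>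
      \<bar>real (hits (block (length z) (X s)) z n) / real n - \<rho> z (fact s)\<bar> < 1 / real (Suc s)"
    by metis
  obtain N where N0: "N 0 = 0" and N: "\<forall>s. (k + 1) * fact s dvd N s \<and>
      (k + 1) * fact s dvd N (Suc s) \<and>
      N s < N (Suc s) \<and> Suc s * N s \<le> N (Suc s) \<and> Suc s * Th (Suc s) \<le> N (Suc s)"
    using stage_boundaries[of k Th] by blast
  have N_dvd: "(k + 1) * fact s dvd N s" "(k + 1) * fact s dvd N (Suc s)"
    and N_less: "N s < N (Suc s)" and N_growth: "Suc s * N s \<le> N (Suc s)"
    and N_Th: "Suc s * Th (Suc s) \<le> N (Suc s)" for s
    using N[rule_format, of s] by auto
  have N_mono: "strict_mono N" using N_less by (simp add: strict_mono_Suc_iff)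
  obtain x where x: "\<And>s i. N s \<le> i \<Longrightarrow> i < N (Suc s) \<Longrightarrow> x i = X s i"
    and "range x \<subseteq> (\<Union>s. range (X s))"
    using splice_exists[OF N_mono N0, of X] by blast
  then have x_range: "range x \<subseteq> insert b A" using X_range by blast
  have "delete_symbol b (InfWord x) = InfWord v"
  proof (rule delete_symbol_eqI)
    fix m
    have prefixes: "filter (\<lambda>c. c \<noteq> b) (map x [0..<N s]) = map v [0..<N s div (k + 1) * k]" for s
    proof (induction s)
      case (Suc s)
      obtain i j where i: "N s = i * ((k + 1) * fact s)" and j: "N (Suc s) = j * ((k + 1) * fact s)"
        using N_dvd[of s] by (metis dvdE mult.commute)
      have "i * ((k + 1) * fact s) \<le> j * ((k + 1) * fact s)" using N_less[of s] i j by simp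
      then have ij: "i \<le> j" by (simp del: mult_Suc mult_Suc_right)
      have i': "N s div (k + 1) * k = i * (k * fact s)"
        and j': "N (Suc s) div (k + 1) * k = j * (k * fact s)"
        unfolding i j by (simp_all add: mult.left_commute[of _ "Suc k"] del: mult_Suc mult_Suc_right)
      have split: "[0..<b] = [0..<a] @ [a..<b]" if "a \<le> b" for a b :: nat
        using upt_add_eq_append[of 0 a "b - a"] that by simp
      have "map x [N s..<N (Suc s)] = map (X s) [N s..<N (Suc s)]"
        using x by simp
      then have "filter (\<lambda>c. c \<noteq> b) (map x [N s..<N (Suc s)])
          = map v [N s div (k + 1) * k..<N (Suc s) div (k + 1) * k]"
        unfolding i' j' using filter_concat_blocks[OF X_filter ij] by (simp only: i j)
      moreover have "N s \<le> N (Suc s)" using N_less[of s] by simp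
      moreover have "N s div (k + 1) * k \<le> N (Suc s) div (k + 1) * k"
        unfolding i' j' using ij by simp
      ultimately show ?case using Suc
        by (simp only: split[of "N s" "N (Suc s)"]
            split[of "N s div (k + 1) * k" "N (Suc s) div (k + 1) * k"] map_append filter_append)
    qed (simp add: N0)
    (* A prefix of length N s reduces to N s div (k + 1) * k letters; s = m * (k + 1) is large
       enough to make this at least m. *)
    have "m * (k + 1) \<le> N (m * (k + 1))" using strict_mono_imp_increasing[OF N_mono] .
    then have "m \<le> N (m * (k + 1)) div (k + 1)" by (simp add: less_eq_div_iff_mult_less_eq)
    also have "\<dots> \<le> N (m * (k + 1)) div (k + 1) * k" using k by simp
    finally show "\<exists>N M. m \<le> M \<and> filter (\<lambda>c. c \<noteq> b) (map x [0..<N]) = map v [0..<M]"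
      using prefixes by blast
  qed
  moreover have "normal_word (insert b A) x"
    unfolding normal_word_def
  proof (intro allI impI)
    fix l :: nat assume l: "l \<ge> 1"
    have "(\<lambda>n. real (hits (block l x) z n) / real n) \<longlonglongrightarrow> 1 / real (k + 1) ^ l"
      if z: "set z \<subseteq> insert b A" "length z = l" for z
    proof -
      define p where "p = 1 / real (k + 1) ^ l"
      have p: "0 \<le> p" "p \<le> 1" by (simp_all add: p_def divide_le_eq)
      define f where "f n = real (hits (block l x) z n) - p * real n" for n
      define g where "g s n = real (hits (block l (X s)) z n) - p * real n" for s n
      define \<nu> where "\<nu> s = N s div l" for s
      (* The first term bounds how far the stage is from its own limit, the second how far that
         limit is from the target p. *)
      define \<epsilon> where "\<epsilon> s = 1 / real (Suc s) + \<bar>\<rho> z (fact s) - p\<bar>" for s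
      have l_dvd: "l dvd N s" "l dvd N (Suc s)" if "l \<le> s" for s
        using dvd_fact[OF l that] N_dvd[of s] by (meson dvd_mult dvd_trans)+
      have \<nu>: "N s = \<nu> s * l" "N (Suc s) = \<nu> (Suc s) * l" if "l \<le> s" for s
        using l_dvd[OF that] by (simp_all add: \<nu>_def)
      have "(\<lambda>n. f n / real n) \<longlonglongrightarrow> 0"
      proof (rule splice_discrepancy[where start = l and \<nu> = \<nu> and g = g and \<epsilon> = \<epsilon>])
        fix n
        have "real (hits (block l x) z n) \<le> real n" by (simp add: hits_le)
        moreover have "p * real n \<le> 1 * real n" using p by (intro mult_right_mono) auto
        moreover have "0 \<le> p * real n" using p by simp
        ultimately show "\<bar>f n\<bar> \<le> real n" unfolding f_def by simp
      next
        fix s n assume s: "l \<le> s" and n: "\<nu> s \<le> n" "n \<le> \<nu> (Suc s)"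
        have "block l x (\<nu> s + e) = block l (X s) (\<nu> s + e)" if "e < n - \<nu> s" for e
        proof -
          have "Suc (\<nu> s + e) * l \<le> \<nu> (Suc s) * l" using that n by (intro mult_le_mono1) simp
          then show ?thesis unfolding block_def
            by (intro map_cong refl x) (auto simp: \<nu>[OF s] algebra_simps)
        qed
        then have "hits (\<lambda>e. block l x (\<nu> s + e)) z (n - \<nu> s)
            = hits (\<lambda>e. block l (X s) (\<nu> s + e)) z (n - \<nu> s)" by (rule hits_cong)
        then show "f n - f (\<nu> s) = g s n - g s (\<nu> s)"
          using hits_add[of "block l x" z "\<nu> s" "n - \<nu> s"]
            hits_add[of "block l (X s)" z "\<nu> s" "n - \<nu> s"] n by (simp add: f_def g_def)
      next
        fix s n assume s: "l \<le> s" and n: "\<nu> s \<le> n"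
        obtain s' where s': "s = Suc s'" using s l by (cases s) auto
        have "l * Th s \<le> s * Th s" using s by simp
        also have "\<dots> \<le> N s" using N_Th[of s'] s' by simp
        finally have "Th s * l \<le> \<nu> s * l" using \<nu>[OF s] by (simp add: mult.commute)
        then have "Th s \<le> n" using l n by simp
        moreover have "z \<in> Z s" using z s l by (auto simp: Z_def)
        ultimately have close: "\<bar>real (hits (block l (X s)) z n) / real n - \<rho> z (fact s)\<bar>
            < 1 / real (Suc s)" using Th[of s n z] z by simp
        then have "\<bar>real (hits (block l (X s)) z n) / real n - p\<bar> \<le> \<epsilon> s"
          unfolding \<epsilon>_def by linarith
        then have "\<bar>real (hits (block l (X s)) z n) / real n - p\<bar> * real n \<le> \<epsilon> s * real n"
          by (intro mult_right_mono) auto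
        moreover have "\<bar>real (hits (block l (X s)) z n) / real n - p\<bar> * real n = \<bar>g s n\<bar>"
          by (cases "n = 0") (simp_all add: g_def abs_mult_pos' field_simps flip: abs_mult_pos)
        ultimately show "\<bar>g s n\<bar> \<le> \<epsilon> s * real n" by simp
      next
        fix s assume s: "l \<le> s"
        have "\<nu> s * l < \<nu> (Suc s) * l" using N_less[of s] \<nu>[OF s] by simp
        then show "\<nu> s < \<nu> (Suc s)" by simp
        have "s * N s \<le> N (Suc s)" using N_growth[of s] by simp
        then have "s * \<nu> s * l \<le> \<nu> (Suc s) * l" using \<nu>[OF s] by (simp add: mult.assoc)
        then show "s * \<nu> s \<le> \<nu> (Suc s)" using l by simp
      next
        have "\<rho> z \<longlonglongrightarrow> p"
          using window_ratio_tendsto[OF A z(1)] z(2) unfolding \<rho>_def p_def k_def by simp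
        moreover have "filterlim (fact :: nat \<Rightarrow> nat) at_top sequentially"
          using fact_ge_self by (intro filterlim_at_top_mono[OF filterlim_ident]) auto
        ultimately have "(\<lambda>s. \<rho> z (fact s)) \<longlonglongrightarrow> p" by (rule filterlim_compose)
        then have "(\<lambda>s. \<bar>\<rho> z (fact s) - p\<bar>) \<longlonglongrightarrow> 0"
          using LIM_zero tendsto_rabs_zero by blast
        then show "\<epsilon> \<longlonglongrightarrow> 0"
          unfolding \<epsilon>_def using tendsto_add[OF LIMSEQ_Suc[OF lim_1_over_n]] by fastforce
        show "0 \<le> \<epsilon> s" for s by (simp add: \<epsilon>_def)
      qed
      then have "(\<lambda>n. f n / real n + p) \<longlonglongrightarrow> 0 + p" by (intro tendsto_intros)
      moreover have "\<forall>\<^sub>F n in sequentially. f n / real n + p = real (hits (block l x) z n) / real n"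
        using eventually_gt_at_top[of 0] by eventually_elim (simp add: f_def field_simps)
      ultimately show ?thesis by (auto simp: p_def intro: Lim_transform_eventually)
    qed
    then show "simply_normal_to_length (insert b A) l x"
      using A l by (simp add: simply_normal_iff_hits k_def)
  qed
  ultimately show ?thesis using x_range by blast
qed

theorem theorem1:
  fixes b :: nat and v :: "nat word"
  assumes "b \<ge> 2"
    and "v \<in> infinite_words {0..<b}"
    and "normal_word {0..<b} v"
  shows "\<exists>v' \<in> infinite_words {0..b}.
           normal_word {0..b} v' \<and> delete_symbol b (InfWord v') = InfWord v"
proof -
  have "insert b {0..<b} = {0..b}" by auto
  then show ?thesis
    using normal_word_by_insertion[of "{0..<b}" b v] assms by (auto simp: infinite_words_def)
qed

end
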